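(* Let $n \ge 1$ be an integer and let $N = n + \frac{1}{2}$. Then, for any integer $k \geq 1$, $$\sum_{j=1}^k 4^j \binom{2k+1}{2j} S_{2j} = 4^k N^{2k+1} - N$$ and $$\sum_{j=1}^k 4^j \binom{2k}{2j-1} S_{2j-1} = 4^k N^{2k} - 1.$$
   Context: For integers $m \ge 0$ and $n \ge 1$, $S_m = 1^m + 2^m + \cdots + n^m$ denotes the sum of the $m$th powers of the first $n$ positive integers (the dependence on $n$ is suppressed in the notation). *)

theory Defs
  imports Complex_Main
begin

definition power_sum :: "nat \<Rightarrow> nat \<Rightarrow> nat" where
  "power_sum m n = (\<Sum>i = 1..n. i ^ m)"

end

theory Submission
  imports Defs
begin

text \<open>
  Evaluate a telescoping sum in two ways. On the one hand, the differences
  \<open>(2 i + 1) ^ m - (2 i - 1) ^ m\<close> for \<open>1 \<le> i \<le> n\<close> add up to \<open>(2 n + 1) ^ m - 1\<close>,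
  which is \<open>(2 N) ^ m - 1\<close>. On the other hand, by the binomial theorem such a difference contains
  only those powers \<open>(2 i) ^ r\<close> for which \<open>m - r\<close> is odd, each with coefficient
  \<open>2 * (m choose r)\<close>; summing over \<open>i\<close> turns \<open>i ^ r\<close> into a power sum. This is
  \<open>binomial_power_sum_telescope\<close>. For \<open>m = 2 k + 1\<close> only the even-indexed power sums
  survive, including \<open>S\<^sub>0 = n\<close>, which is what turns the constant \<open>1/2\<close> into \<open>N = n + 1/2\<close>;
  for \<open>m = 2 k\<close> only the odd-indexed ones survive.
\<close>

lemma central_difference_power:
  fixes x :: "'a::comm_ring_1"
  shows "(x + 1) ^ m - (x - 1) ^ m = (\<Sum>r\<le>m. of_nat (m choose r) * (1 - (-1) ^ (m - r)) * x ^ r)"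
proof -
  have "(x + 1) ^ m = (\<Sum>r\<le>m. of_nat (m choose r) * x ^ r)"
    using binomial_ring[of x 1 m] by simp
  moreover have "(x - 1) ^ m = (\<Sum>r\<le>m. of_nat (m choose r) * x ^ r * (-1) ^ (m - r))"
    using binomial_ring[of x "-1" m] by simp
  ultimately show ?thesis
    by (simp add: sum_subtractf[symmetric] algebra_simps)
qed

text \<open>
  The factor \<open>1 - (-1) ^ (m - r)\<close> is \<open>2\<close> or \<open>0\<close>, so it selects the exponents of parity opposite
  to \<open>m\<close> without committing to a parity of \<open>m\<close>; both identities of the theorem are instances.
\<close>

lemma binomial_power_sum_telescope:
  "(\<Sum>r\<le>m. real (m choose r) * (1 - (-1) ^ (m - r)) * 2 ^ r * real (power_sum r n))
     = (2 * real n + 1) ^ m - 1"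
proof (induction n)
  case 0
  then show ?case by (simp add: power_sum_def)
next
  case (Suc n)
  let ?c = "\<lambda>r. real (m choose r) * (1 - (-1) ^ (m - r))"
  have "(\<Sum>r\<le>m. ?c r * 2 ^ r * real (power_sum r (Suc n)))
      = (\<Sum>r\<le>m. ?c r * 2 ^ r * real (power_sum r n)) + (\<Sum>r\<le>m. ?c r * (2 * real (Suc n)) ^ r)"
    by (simp add: power_sum_def sum.distrib[symmetric] distrib_left power_mult_distrib mult.assoc
             del: of_nat_Suc)
  also have "\<dots> = ((2 * real n + 1) ^ m - 1)
      + ((2 * real (Suc n) + 1) ^ m - (2 * real (Suc n) - 1) ^ m)"
    by (simp only: Suc.IH central_difference_power)
  also have "2 * real (Suc n) - 1 = 2 * real n + 1" by simp
  finally show ?case by simp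
qed

lemma sum_atMost_even_pairs:
  fixes f :: "nat \<Rightarrow> 'a::comm_monoid_add"
  shows "(\<Sum>r\<le>2 * k + 1. f r) = (\<Sum>j\<le>k. f (2 * j) + f (2 * j + 1))"
  by (induction k) (simp_all add: add.assoc)

lemma sum_atMost_odd_pairs:
  fixes f :: "nat \<Rightarrow> 'a::comm_monoid_add"
  shows "(\<Sum>r\<le>2 * k. f r) = f 0 + (\<Sum>j = 1..k. f (2 * j - 1) + f (2 * j))"
  by (induction k) (simp_all add: add.assoc)

theorem theorem1:
  fixes n k :: nat and N :: real
  assumes "n \<ge> 1" and "k \<ge> 1" and "N = real n + 1 / 2"
  shows "(\<Sum>j = 1..k. 4 ^ j * real ((2 * k + 1) choose (2 * j)) * real (power_sum (2 * j) n))
           = 4 ^ k * N ^ (2 * k + 1) - N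
       \<and> (\<Sum>j = 1..k. 4 ^ j * real ((2 * k) choose (2 * j - 1)) * real (power_sum (2 * j - 1) n))
           = 4 ^ k * N ^ (2 * k) - 1"
proof
  have N: "2 * real n + 1 = 2 * N" using assms(3) by simp
  let ?g = "\<lambda>m r. real (m choose r) * (1 - (-1) ^ (m - r)) * 2 ^ r * real (power_sum r n)"
  let ?e = "\<lambda>j. 4 ^ j * real ((2 * k + 1) choose (2 * j)) * real (power_sum (2 * j) n)"
  have "(2 * N) ^ (2 * k + 1) - 1 = (\<Sum>r\<le>2 * k + 1. ?g (2 * k + 1) r)"
    by (simp only: binomial_power_sum_telescope N)
  also have "\<dots> = (\<Sum>j\<le>k. 2 * ?e j)"
    unfolding sum_atMost_even_pairs
  proof (rule sum.cong[OF refl])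
    fix j assume "j \<in> {..k}"
    then have "odd (2 * k + 1 - 2 * j)" "even (2 * k + 1 - (2 * j + 1))" by auto
    then show "?g (2 * k + 1) (2 * j) + ?g (2 * k + 1) (2 * j + 1) = 2 * ?e j"
      by (simp add: power_mult del: binomial_Suc_Suc)
  qed
  also have "\<dots> = 2 * real n + 2 * (\<Sum>j = 1..k. ?e j)"
    by (simp add: atMost_atLeast0 sum.atLeast_Suc_atMost power_sum_def sum_distrib_left)
  finally have "(2 * N) ^ (2 * k + 1) - 1 = 2 * real n + 2 * (\<Sum>j = 1..k. ?e j)" .
  moreover have "(2 * N) ^ (2 * k + 1) = 2 * (4 ^ k * N ^ (2 * k + 1))"
    by (simp add: power_mult_distrib power_mult)
  ultimately show "(\<Sum>j = 1..k. ?e j) = 4 ^ k * N ^ (2 * k + 1) - N"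
    using N by linarith

  let ?o = "\<lambda>j. 4 ^ j * real ((2 * k) choose (2 * j - 1)) * real (power_sum (2 * j - 1) n)"
  have "(2 * N) ^ (2 * k) - 1 = (\<Sum>r\<le>2 * k. ?g (2 * k) r)"
    by (simp only: binomial_power_sum_telescope N)
  also have "\<dots> = (\<Sum>j = 1..k. ?g (2 * k) (2 * j - 1) + ?g (2 * k) (2 * j))"
    by (simp add: sum_atMost_odd_pairs)
  also have "\<dots> = (\<Sum>j = 1..k. ?o j)"
  proof (rule sum.cong[OF refl])
    fix j assume "j \<in> {1..k}"
    then have "odd (2 * k - (2 * j - 1))" "even (2 * k - 2 * j)" by auto
    then have signs: "(-1 :: real) ^ (2 * k - (2 * j - 1)) = -1"
        "(-1 :: real) ^ (2 * k - 2 * j) = 1"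
      by (blast intro: neg_one_odd_power neg_one_even_power)+
    have four: "4 ^ j = 2 * (2 :: real) ^ (2 * j - 1)"
      using \<open>j \<in> {1..k}\<close> by (simp add: power_mult flip: power_Suc)
    show "?g (2 * k) (2 * j - 1) + ?g (2 * k) (2 * j) = ?o j"
      unfolding signs four by simp
  qed
  finally show "(\<Sum>j = 1..k. ?o j) = 4 ^ k * N ^ (2 * k) - 1"
    by (simp add: power_mult_distrib power_mult)
qed

end
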